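(* Let $L=\{0,+,-\}$ be the three-element monoid with identity $0$ and two left zeroes $+,-$. A finite semigroup embeds (as a subsemigroup) in the face monoid of some real central hyperplane arrangement if and only if it belongs to the quasivariety $\mathrm{qv}(L)$ generated by $L$.
   Context: In $L$, the element $0$ is the identity and $xy=x$ for all $x\in\{+,-\}$ and $y\in L$. For a finite semigroup $S$, the quasivariety $\mathrm{qv}(S)$ generated by $S$ consists of all semigroups isomorphic to a subsemigroup of a direct power of $S$. A (real, central) hyperplane arrangement $\mathcal A$ in $\mathbb R^d$ is a finite set of hyperplanes $\{f_1=0\},\ldots,\{f_n=0\}$ through the origin, where $f_1,\dots,f_n$ are nonzero linear forms. Let $\mathbf s\colon\mathbb R\to L$ send $x$ to $+$, $0$ or $-$ according to whether $x>0$, $x=0$ or $x<0$, and let $\sigma(\vec x)=(\mathbf s(f_1(\vec x)),\ldots,\mathbf s(f_n(\vec x)))\in L^n$. The face monoid of $\mathcal A$ is $\mathcal F=\sigma(\mathbb R^d)\subseteq L^n$ with the product of $L^n$; its elements are the sign sequences of the faces of $\mathcal A$. *)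

theory Defs
  imports "HOL-Library.FuncSet" "Jordan_Normal_Form.Matrix"
begin

section \<open>Semigroups\<close>

text \<open>Semigroups with an explicit carrier. The empty carrier is not excluded.\<close>

record 'a semigrp = "'a partial_object" +
  sop :: "'a \<Rightarrow> 'a \<Rightarrow> 'a"

definition is_semigroup :: "'a semigrp \<Rightarrow> bool" where
  "is_semigroup S \<longleftrightarrow>
     (\<forall>x\<in>carrier S. \<forall>y\<in>carrier S. sop S x y \<in> carrier S) \<and>
     (\<forall>x\<in>carrier S. \<forall>y\<in>carrier S. \<forall>z\<in>carrier S.
        sop S (sop S x y) z = sop S x (sop S y z))"

definition is_subsemigroup :: "'a set \<Rightarrow> 'a semigrp \<Rightarrow> bool" where
  "is_subsemigroup U T \<longleftrightarrow>
     U \<subseteq> carrier T \<and> (\<forall>x\<in>U. \<forall>y\<in>U. sop T x y \<in> U)"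

definition is_iso :: "('a \<Rightarrow> 'b) \<Rightarrow> 'a semigrp \<Rightarrow> 'b semigrp \<Rightarrow> bool" where
  "is_iso h S T \<longleftrightarrow>
     bij_betw h (carrier S) (carrier T) \<and>
     (\<forall>x\<in>carrier S. \<forall>y\<in>carrier S. h (sop S x y) = sop T (h x) (h y))"

definition embeds :: "'a semigrp \<Rightarrow> 'b semigrp \<Rightarrow> bool" where
  "embeds S T \<longleftrightarrow>
     (\<exists>U h. is_subsemigroup U T \<and> is_iso h S \<lparr>carrier = U, sop = sop T\<rparr>)"

definition direct_power :: "'i set \<Rightarrow> 's semigrp \<Rightarrow> ('i \<Rightarrow> 's) semigrp" where
  "direct_power I S =
     \<lparr>carrier = I \<rightarrow>\<^sub>E carrier S, sop = (\<lambda>x y. \<lambda>i\<in>I. sop S (x i) (y i))\<rparr>"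

text \<open>The members with carrier in a type \<open>'a\<close> of the quasivariety generated by a finite
  semigroup \<open>S\<close>. HOL cannot quantify over all index sets at once, so the index sets range
  over the subsets of a type \<open>'i\<close>. For finite members every infinite \<open>'i\<close> gives
  the unrestricted notion, because finitely many coordinates suffice to separate finitely
  many points.\<close>

definition qv :: "'i itself \<Rightarrow> 's semigrp \<Rightarrow> 'a semigrp set" where
  "qv (_ :: 'i itself) S =
     {T. is_semigroup T \<and> (\<exists>I :: 'i set. embeds T (direct_power I S))}"

section \<open>The monoid L\<close>

datatype sign = SZero | SPlus | SMinus

instantiation sign :: monoid_mult
begin

definition one_sign :: sign where
  "one_sign = SZero"

definition times_sign :: "sign \<Rightarrow> sign \<Rightarrow> sign" where
  "times_sign x y = (if x = SZero then y else x)"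

instance
  by standard (auto simp: one_sign_def times_sign_def)

end

definition L :: "sign semigrp" where
  "L = \<lparr>carrier = UNIV, sop = (*)\<rparr>"

section \<open>Central hyperplane arrangements and their face monoids\<close>

text \<open>Real \<open>d\<close>-space is \<^term>\<open>carrier_vec d :: real vec set\<close>.\<close>

definition is_linear_form :: "nat \<Rightarrow> (real vec \<Rightarrow> real) \<Rightarrow> bool" where
  "is_linear_form d f \<longleftrightarrow>
     (\<forall>x\<in>carrier_vec d. \<forall>y\<in>carrier_vec d. f (x + y) = f x + f y) \<and>
     (\<forall>c. \<forall>x\<in>carrier_vec d. f (c \<cdot>\<^sub>v x) = c * f x)"

definition is_nonzero_linear_form :: "nat \<Rightarrow> (real vec \<Rightarrow> real) \<Rightarrow> bool" where
  "is_nonzero_linear_form d f \<longleftrightarrow>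
     is_linear_form d f \<and> (\<exists>x\<in>carrier_vec d. f x \<noteq> 0)"

definition hyperplane :: "nat \<Rightarrow> (real vec \<Rightarrow> real) \<Rightarrow> real vec set" where
  "hyperplane d f = {x \<in> carrier_vec d. f x = 0}"

text \<open>The forms \<open>f 0, \<dots>, f (n - 1)\<close> present the arrangement
  \<open>{hyperplane d (f i) | i < n}\<close>. As this is a set of \<open>n\<close> hyperplanes, the hyperplanes are
  pairwise distinct.\<close>

definition central_arrangement :: "nat \<Rightarrow> nat \<Rightarrow> (nat \<Rightarrow> real vec \<Rightarrow> real) \<Rightarrow> bool" where
  "central_arrangement d n f \<longleftrightarrow>
     (\<forall>i<n. is_nonzero_linear_form d (f i)) \<and>
     inj_on (\<lambda>i. hyperplane d (f i)) {..<n}"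

definition sign_of :: "real \<Rightarrow> sign" where
  "sign_of x = (if x > 0 then SPlus else if x = 0 then SZero else SMinus)"

definition sign_vector :: "nat \<Rightarrow> (nat \<Rightarrow> real vec \<Rightarrow> real) \<Rightarrow> real vec \<Rightarrow> nat \<Rightarrow> sign" where
  "sign_vector n f x = (\<lambda>i\<in>{..<n}. sign_of (f i x))"

definition face_monoid :: "nat \<Rightarrow> nat \<Rightarrow> (nat \<Rightarrow> real vec \<Rightarrow> real) \<Rightarrow> (nat \<Rightarrow> sign) semigrp" where
  "face_monoid d n f =
     \<lparr>carrier = sign_vector n f ` carrier_vec d, sop = sop (direct_power {..<n} L)\<rparr>"

end

(* The coordinate hyperplanes of real n-space have all of L^n as face monoid. So the face monoids
   of arrangements and the finite powers of L have the same finite subsemigroups up to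
   isomorphism, and finitely many coordinates suffice to separate the elements of a finite
   subsemigroup of a power of L. *)

theory Submission
  imports Defs
begin

text \<open>An injective homomorphism is an isomorphism onto its image, and the image is closed
  under \<open>sop T\<close> because \<open>S\<close> is closed under \<open>sop S\<close>. This
  trades the subset \<open>U\<close> for a single map in the later arguments.\<close>

lemma embeds_iff_inj_hom:
  assumes "is_semigroup S"
  shows "embeds S T \<longleftrightarrow>
    (\<exists>h. h \<in> carrier S \<rightarrow> carrier T \<and> inj_on h (carrier S) \<and>
      (\<forall>x\<in>carrier S. \<forall>y\<in>carrier S. h (sop S x y) = sop T (h x) (h y)))"
    (is "_ \<longleftrightarrow> (\<exists>h. ?P h)")
proof
  assume "embeds S T"
  then obtain U h where "is_subsemigroup U T" "is_iso h S \<lparr>carrier = U, sop = sop T\<rparr>"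
    unfolding embeds_def by blast
  then have "?P h"
    by (auto simp: is_subsemigroup_def is_iso_def bij_betw_def)
  then show "\<exists>h. ?P h" by (intro exI[of _ h])
next
  assume "\<exists>h. ?P h"
  then obtain h where h: "?P h" ..
  have "is_subsemigroup (h ` carrier S) T"
    unfolding is_subsemigroup_def
  proof (intro conjI ballI)
    show "h ` carrier S \<subseteq> carrier T"
      using h by auto
    fix u v assume "u \<in> h ` carrier S" "v \<in> h ` carrier S"
    then obtain x y where xy: "x \<in> carrier S" "y \<in> carrier S" "u = h x" "v = h y"
      by blast
    then have "sop T u v = h (sop S x y)"
      using h by simp
    then show "sop T u v \<in> h ` carrier S"
      using assms xy by (auto simp: is_semigroup_def)
  qed
  moreover have "is_iso h S \<lparr>carrier = h ` carrier S, sop = sop T\<rparr>"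
    using h by (simp add: is_iso_def bij_betw_def)
  ultimately show "embeds S T"
    unfolding embeds_def by blast
qed

text \<open>A map into a power amounts to a family of coordinate maps, \<open>g i x\<close> being
  \<open>h x i\<close>. The homomorphism law can be checked in each coordinate, and injectivity
  becomes joint separation of points.\<close>

lemma embeds_direct_power_iff:
  assumes "is_semigroup S"
  shows "embeds S (direct_power I T) \<longleftrightarrow>
    (\<exists>g. (\<forall>i\<in>I. g i \<in> carrier S \<rightarrow> carrier T) \<and>
      (\<forall>i\<in>I. \<forall>x\<in>carrier S. \<forall>y\<in>carrier S. g i (sop S x y) = sop T (g i x) (g i y)) \<and>
      (\<forall>x\<in>carrier S. \<forall>y\<in>carrier S. x \<noteq> y \<longrightarrow> (\<exists>i\<in>I. g i x \<noteq> g i y)))"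
    (is "_ \<longleftrightarrow> (\<exists>g. ?P g)")
proof
  assume "embeds S (direct_power I T)"
  then obtain h where h: "h \<in> carrier S \<rightarrow> (I \<rightarrow>\<^sub>E carrier T)" "inj_on h (carrier S)"
    "\<And>x y. x \<in> carrier S \<Longrightarrow> y \<in> carrier S \<Longrightarrow>
      h (sop S x y) = (\<lambda>i\<in>I. sop T (h x i) (h y i))"
    unfolding embeds_iff_inj_hom[OF assms] direct_power_def by auto
  \<comment> \<open>Members of the power are extensional, so two distinct ones already differ at an
    index in \<open>I\<close>.\<close>
  have "\<exists>i\<in>I. h x i \<noteq> h y i" if "x \<in> carrier S" "y \<in> carrier S" "x \<noteq> y" for x y
    using that h(1,2) by (metis PiE_ext Pi_iff inj_on_eq_iff)
  then have "?P (\<lambda>i x. h x i)"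
    using h(1) by (auto simp: h(3))
  then show "\<exists>g. ?P g" by (intro exI[of _ "\<lambda>i x. h x i"])
next
  assume "\<exists>g. ?P g"
  then obtain g where g: "?P g" ..
  \<comment> \<open>Restricting to \<open>I\<close> makes \<open>h x\<close> extensional, as
    membership in the power demands.\<close>
  define h where "h x = (\<lambda>i\<in>I. g i x)" for x
  have "inj_on h (carrier S)"
    unfolding inj_on_def h_def using g by (metis restrict_apply')
  moreover have "h \<in> carrier S \<rightarrow> carrier (direct_power I T)"
    using g by (simp add: h_def direct_power_def Pi_iff restrict_PiE_iff)
  moreover have "h (sop S x y) = sop (direct_power I T) (h x) (h y)"
    if "x \<in> carrier S" "y \<in> carrier S" for x y
    using g that by (auto simp: h_def direct_power_def)
  ultimately show "embeds S (direct_power I T)"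
    unfolding embeds_iff_inj_hom[OF assms] by blast
qed

text \<open>Renaming the coordinates keeps a separating family of homomorphisms. This carries
  embeddings between index sets in an arbitrary type and the initial segments of \<open>nat\<close>
  that number the hyperplanes.\<close>

lemma embeds_direct_power_reindex:
  assumes "is_semigroup S" "embeds S (direct_power I T)" "bij_betw \<phi> J I"
  shows "embeds S (direct_power J T)"
proof -
  have I: "I = \<phi> ` J"
    using assms(3) by (simp add: bij_betw_def)
  obtain g where
    "\<forall>i\<in>I. g i \<in> carrier S \<rightarrow> carrier T"
    "\<forall>i\<in>I. \<forall>x\<in>carrier S. \<forall>y\<in>carrier S. g i (sop S x y) = sop T (g i x) (g i y)"
    "\<forall>x\<in>carrier S. \<forall>y\<in>carrier S. x \<noteq> y \<longrightarrow> (\<exists>i\<in>I. g i x \<noteq> g i y)"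
    using assms(2) unfolding embeds_direct_power_iff[OF assms(1)] by blast
  then show ?thesis
    unfolding embeds_direct_power_iff[OF assms(1)] I by (intro exI[of _ "g \<circ> \<phi>"]) simp
qed

lemma embeds_finite_direct_power:
  assumes "is_semigroup S" "finite (carrier S)" "embeds S (direct_power I T)"
  obtains J where "J \<subseteq> I" "finite J" "embeds S (direct_power J T)"
proof -
  obtain g where g:
    "\<forall>i\<in>I. g i \<in> carrier S \<rightarrow> carrier T"
    "\<forall>i\<in>I. \<forall>x\<in>carrier S. \<forall>y\<in>carrier S. g i (sop S x y) = sop T (g i x) (g i y)"
    "\<forall>x\<in>carrier S. \<forall>y\<in>carrier S. x \<noteq> y \<longrightarrow> (\<exists>i\<in>I. g i x \<noteq> g i y)"
    using assms(3) unfolding embeds_direct_power_iff[OF assms(1)] by blast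
  define D where "D = {(x, y). x \<in> carrier S \<and> y \<in> carrier S \<and> x \<noteq> y}"
  have "\<forall>p\<in>D. \<exists>i\<in>I. g i (fst p) \<noteq> g i (snd p)"
    using g(3) by (auto simp: D_def)
  \<comment> \<open>The choice function \<open>s\<close> picks a separating coordinate for each
    pair; the image of \<open>D\<close> under it is the finite index set.\<close>
  then obtain s where s: "\<forall>p\<in>D. s p \<in> I \<and> g (s p) (fst p) \<noteq> g (s p) (snd p)"
    by metis
  have sep: "\<exists>i\<in>s ` D. g i x \<noteq> g i y"
    if "x \<in> carrier S" "y \<in> carrier S" "x \<noteq> y" for x y
    using s that by (intro bexI[of _ "s (x, y)"]) (auto simp: D_def)
  have sub: "s ` D \<subseteq> I"
    using s by auto
  have "finite D"
    by (rule finite_subset[of _ "carrier S \<times> carrier S"]) (auto simp: D_def assms(2))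
  moreover have "embeds S (direct_power (s ` D) T)"
    unfolding embeds_direct_power_iff[OF assms(1)]
  proof (intro exI[of _ g] conjI)
    show "\<forall>i\<in>s ` D. g i \<in> carrier S \<rightarrow> carrier T"
      using g(1) sub by (meson subsetD)
    show "\<forall>i\<in>s ` D. \<forall>x\<in>carrier S. \<forall>y\<in>carrier S. g i (sop S x y) = sop T (g i x) (g i y)"
      using g(2) sub by (meson subsetD)
  qed (use sep in simp)
  ultimately show ?thesis
    using that sub by blast
qed

lemma sign_vector_in_PiE:
  "sign_vector n f x \<in> {..<n} \<rightarrow>\<^sub>E UNIV"
  unfolding sign_vector_def by (intro restrict_PiE_iff[THEN iffD2] ballI UNIV_I)

text \<open>The face monoid sits inside the power with the same operation, so an injective
  homomorphism into the former is one into the latter.\<close>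

lemma embeds_face_monoid_imp_direct_power:
  assumes "is_semigroup S" "embeds S (face_monoid d n f)"
  shows "embeds S (direct_power {..<n} L)"
proof -
  have "carrier (face_monoid d n f) \<subseteq> carrier (direct_power {..<n} L)"
    using sign_vector_in_PiE by (auto simp only: face_monoid_def direct_power_def L_def partial_object.simps)
  moreover have "sop (face_monoid d n f) = sop (direct_power {..<n} L)"
    by (simp add: face_monoid_def)
  ultimately show ?thesis
    using assms(2) unfolding embeds_iff_inj_hom[OF assms(1)] by (fastforce simp: Pi_iff)
qed

lemma central_arrangement_coordinates:
  "central_arrangement n n (\<lambda>i x. x $ i)"
  unfolding central_arrangement_def
proof (intro conjI allI impI inj_onI)
  fix i assume "i < n"
  then show "is_nonzero_linear_form n (\<lambda>x. x $ i)"
    by (auto simp: is_nonzero_linear_form_def is_linear_form_def intro!: bexI[of _ "unit_vec n i"])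
next
  fix i j assume ij: "i \<in> {..<n}" "j \<in> {..<n}"
    and eq: "hyperplane n (\<lambda>x. x $ i) = hyperplane n (\<lambda>x. x $ j)"
  show "i = j"
  proof (rule ccontr)
    assume "i \<noteq> j"
    \<comment> \<open>The \<open>j\<close>-th unit vector lies on every coordinate hyperplane except
      the \<open>j\<close>-th, which tells the two apart.\<close>
    then have "unit_vec n j \<in> hyperplane n (\<lambda>x. x $ i)"
      using ij by (simp add: hyperplane_def)
    then show False
      using ij unfolding eq by (simp add: hyperplane_def)
  qed
qed

text \<open>The coordinates of a vector can be chosen independently, so every sign sequence
  occurs.\<close>

lemma face_monoid_coordinates:
  "face_monoid n n (\<lambda>i x. x $ i) = direct_power {..<n} L"
proof -
  have "u \<in> sign_vector n (\<lambda>i x. x $ i) ` carrier_vec n"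
    if u: "u \<in> {..<n} \<rightarrow>\<^sub>E (UNIV :: sign set)" for u
  proof
    \<comment> \<open>\<open>r\<close> is a right inverse of \<open>sign_of\<close>: it picks a real
      number of each sign.\<close>
    define r :: "sign \<Rightarrow> real" where "r s = (case s of SZero \<Rightarrow> 0 | SPlus \<Rightarrow> 1 | SMinus \<Rightarrow> -1)" for s
    have "sign_of (r s) = s" for s
      by (cases s) (simp_all add: r_def sign_of_def)
    \<comment> \<open>Below \<open>n\<close> both sides agree by the choice of \<open>r\<close>;
      from \<open>n\<close> on both are \<open>undefined\<close>.\<close>
    then show "u = sign_vector n (\<lambda>i x. x $ i) (vec n (\<lambda>i. r (u i)))"
      using u by (intro ext) (auto simp: sign_vector_def PiE_def extensional_def)
  qed simp
  moreover have "sign_vector n (\<lambda>i x. x $ i) ` carrier_vec n \<subseteq> {..<n} \<rightarrow>\<^sub>E (UNIV :: sign set)"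
    using sign_vector_in_PiE by blast
  ultimately have "sign_vector n (\<lambda>i x. x $ i) ` carrier_vec n = {..<n} \<rightarrow>\<^sub>E (UNIV :: sign set)"
    by blast
  then show ?thesis
    by (simp add: face_monoid_def direct_power_def L_def)
qed

theorem mainTheorem2:
  fixes S :: "'a semigrp"
  assumes "is_semigroup S"
    and "finite (carrier S)"
    and "infinite (UNIV :: 'i set)"
  shows "(\<exists>d n f. central_arrangement d n f \<and> embeds S (face_monoid d n f))
         \<longleftrightarrow> S \<in> qv TYPE('i) L"
proof
  assume "\<exists>d n f. central_arrangement d n f \<and> embeds S (face_monoid d n f)"
  then obtain n :: nat where n: "embeds S (direct_power {..<n} L)"
    using embeds_face_monoid_imp_direct_power[OF assms(1)] by blast
  \<comment> \<open>Infinity of \<open>'i\<close> provides index sets of every finite size.\<close>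
  obtain I :: "'i set" where "finite I" "card I = n"
    using infinite_arbitrarily_large[OF assms(3)] by blast
  then obtain \<phi> where "bij_betw \<phi> I {..<n}"
    using ex_bij_betw_finite_nat[of I] by (auto simp: atLeast0LessThan)
  then have "embeds S (direct_power I L)"
    by (rule embeds_direct_power_reindex[OF assms(1) n])
  then show "S \<in> qv TYPE('i) L"
    using assms(1) by (auto simp: qv_def)
next
  assume "S \<in> qv TYPE('i) L"
  then obtain I :: "'i set" where "embeds S (direct_power I L)"
    by (auto simp: qv_def)
  then obtain J :: "'i set" where J: "finite J" "embeds S (direct_power J L)"
    using embeds_finite_direct_power[OF assms(1,2)] by metis
  \<comment> \<open>Both the dimension and the number of hyperplanes will be \<open>card J\<close>.
    If \<open>J\<close> is empty, this is the empty arrangement in dimension 0, whose face monoid is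
    trivial.\<close>
  obtain \<phi> where "bij_betw \<phi> {..<card J} J"
    using ex_bij_betw_nat_finite[OF J(1)] by (auto simp: atLeast0LessThan)
  then have "embeds S (direct_power {..<card J} L)"
    by (rule embeds_direct_power_reindex[OF assms(1) J(2)])
  then show "\<exists>d n f. central_arrangement d n f \<and> embeds S (face_monoid d n f)"
    using central_arrangement_coordinates[of "card J"]
    unfolding face_monoid_coordinates[symmetric] by blast
qed

end
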